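(* Let $T,T'$ be $\mathfrak B$-strata such that $T'$ is a direct derivate of $T$. For nonempty sets $U\subset T$ and $P\subset T'$ put $$L(U)=\{Z\in T'\mid [W,Z[\,\subset T\text{ for all }W\in U\},\qquad S(P)=\{W\in T\mid [W,Z[\,\subset T\text{ for all }Z\in P\}.$$ (a) If $\emptyset\neq U\subset T$ and $L(U)\neq\emptyset$, then $LSL(U)=L(U)$, and $SL(U)$ contains every set $U_1\subset T$ with $U_1\supset U$ and $L(U_1)=L(U)$. (b) If $\emptyset\ne P\subset T'$ and $S(P)\neq\emptyset$, then $SLS(P)=S(P)$, and $LS(P)$ contains every set $P_1\subset T'$ with $P_1\supset P$ and $S(P_1)=S(P)$.
   Context: $R=\{0\}\cup G$ is a bipotent semifield: $G$ is a nontrivial totally ordered abelian group written multiplicatively with unit $e=1$, $0$ is absorbing and smaller than all elements of $G$, and addition is $x+y=\max\{x,y\}$. $R$ is root closed: every element has an $n$-th root in $R$ for all $n\in\mathbb N$. $V$ is an $R$-module with a quadratic form $q:V\to R$ ($q(\lambda x)=\lambda^2q(x)$) and a symmetric bilinear companion $b$ ($q(x+y)=q(x)+q(y)+b(x,y)$); $q$ is anisotropic: $q(x)\neq0$ for $x\ne0$. A ray in $V$ is a class of the equivalence relation on $V\setminus\{0\}$: $x\sim y$ iff $\lambda x=\mu y$ for some $\lambda,\mu\in R\setminus\{0\}$; $\mathrm{ray}(x)$ is the class of $x$, and $\mathrm{Ray}(V)$ is the set of rays. For rays $X=\mathrm{ray}(x)$, $Y=\mathrm{ray}(y)$: $[X,Y]$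 is the set of all $\mathrm{ray}(\lambda x+\mu y)$ with $\lambda,\mu\in R$ not both $0$, and $[X,Y[\,=[X,Y]\setminus\{Y\}$. $\mathrm{CS}(X,Y)=b(x,y)^2/(q(x)q(y))$ for $x\in X$, $y\in Y$. For a finite set of rays $S=\{Y_1,\dots,Y_n\}$, a function $f:\mathrm{Ray}(V)\to R$ is $S$-basic if $f=\sum_{j=1}^n\gamma_j\mathrm{CS}(Y_j,-)$ with $\gamma_j\in R$. (In the claim, $S(P)$ and the operator $S$ are unrelated to this set $S$.) $\mathfrak B=\{f_1,\dots,f_m\}$ is a finite set of $S$-basic functions. A basic $\mathfrak B$-type is a conjunction $\bigwedge_{1\le k<\ell\le m}(f_k\,\Box_{k,\ell}\,f_\ell)$ with signs $\Box_{k,\ell}\in\{<,=,>\}$ that is satisfied by some ray; its stratum is the (nonempty) set of all rays satisfying it, denoted by the same letter. For different strata $T,T'$, $T'$ is a direct derivate of $T$ if there are rays $W\in T$, $W'\in T'$ and $Z\in[W,W']$ with $[W,W']\cap T=[W,Z[$, $[W,W']\cap T'=[Z,W']$ and $[W,W']\subset T\cup T'$. (Then $T'$ arises from $T$ by replacing some of the signs $<,>$ by $=$.) *)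

theory Defs
  imports Main "HOL-Library.FuncSet"
begin

text \<open>
  Since \<open>x + y = max x y\<close> and \<open>0\<close> is the unit of addition, \<open>0\<close> is the least element, and
  distributivity makes multiplication compatible with the order; so the nonzero elements form a
  totally ordered abelian group (see the lemmas below). The last axiom says that this group is
  nontrivial. Nothing is assumed about \<open>inverse 0\<close>.
\<close>
class bipotent_semifield = comm_semiring_1 + linorder + inverse +
  assumes add_eq_max: "x + y = max x y"
    and left_inverse_nonzero: "x \<noteq> 0 \<Longrightarrow> inverse x * x = 1"
    and divide_eq_mult_inverse: "x / y = x * inverse y"
    and nontrivial_units: "\<exists>x. x \<noteq> 0 \<and> x \<noteq> 1"

lemma bipotent_zero_least: "0 \<le> (x :: 'r :: bipotent_semifield)"
  by (metis add_eq_max add_0 max.cobounded1)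

lemma bipotent_mult_nonzero:
  fixes x y :: "'r :: bipotent_semifield"
  assumes "x \<noteq> 0" "y \<noteq> 0"
  shows "x * y \<noteq> 0"
proof
  assume "x * y = 0"
  then have "inverse x * x * y = 0" by (simp add: mult.assoc)
  with assms show False by (simp add: left_inverse_nonzero)
qed

lemma bipotent_mult_strict_mono:
  fixes x y z :: "'r :: bipotent_semifield"
  assumes "x < y" "z \<noteq> 0"
  shows "z * x < z * y"
proof -
  have "z * y = max (z * x) (z * y)"
    by (metis add_eq_max assms(1) distrib_left less_imp_le max.absorb2)
  then have "z * x \<le> z * y" by (metis max.cobounded1)
  moreover have "z * x \<noteq> z * y"
  proof
    assume "z * x = z * y"
    then have "inverse z * z * x = inverse z * z * y" by (simp add: mult.assoc)
    with assms show False by (simp add: left_inverse_nonzero)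
  qed
  ultimately show ?thesis by simp
qed

definition root_closed :: "'r :: bipotent_semifield itself \<Rightarrow> bool" where
  "root_closed _ \<longleftrightarrow> (\<forall>a :: 'r. \<forall>n :: nat. n > 0 \<longrightarrow> (\<exists>c. c ^ n = a))"

locale semimodule =
  fixes scale :: "'r :: comm_semiring_1 \<Rightarrow> 'v :: comm_monoid_add \<Rightarrow> 'v"
  assumes scale_add_right: "scale c (x + y) = scale c x + scale c y"
    and scale_add_left: "scale (c + d) x = scale c x + scale d x"
    and scale_scale: "scale c (scale d x) = scale (c * d) x"
    and scale_one: "scale 1 x = x"
    and scale_zero_left: "scale 0 x = 0"
    and scale_zero_right: "scale c 0 = 0"

definition symmetric_bilinear ::
  "('r :: comm_semiring_1 \<Rightarrow> 'v :: comm_monoid_add \<Rightarrow> 'v) \<Rightarrow> ('v \<Rightarrow> 'v \<Rightarrow> 'r) \<Rightarrow> bool" where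
  "symmetric_bilinear scale b \<longleftrightarrow>
     (\<forall>x y. b x y = b y x) \<and>
     (\<forall>x x' y. b (x + x') y = b x y + b x' y) \<and>
     (\<forall>x y y'. b x (y + y') = b x y + b x y') \<and>
     (\<forall>c x y. b (scale c x) y = c * b x y) \<and>
     (\<forall>c x y. b x (scale c y) = c * b x y)"

definition quadratic_form_with_companion ::
  "('r :: comm_semiring_1 \<Rightarrow> 'v :: comm_monoid_add \<Rightarrow> 'v) \<Rightarrow> ('v \<Rightarrow> 'r) \<Rightarrow> ('v \<Rightarrow> 'v \<Rightarrow> 'r) \<Rightarrow> bool"
  where
  "quadratic_form_with_companion scale q b \<longleftrightarrow>
     (\<forall>c x. q (scale c x) = c ^ 2 * q x) \<and>
     symmetric_bilinear scale b \<and>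
     (\<forall>x y. q (x + y) = q x + q y + b x y)"

definition anisotropic :: "('v :: zero \<Rightarrow> 'r :: zero) \<Rightarrow> bool" where
  "anisotropic q \<longleftrightarrow> (\<forall>x. x \<noteq> 0 \<longrightarrow> q x \<noteq> 0)"

definition ray_rel :: "('r :: zero \<Rightarrow> 'v :: zero \<Rightarrow> 'v) \<Rightarrow> ('v \<times> 'v) set" where
  "ray_rel scale =
     {(x, y). x \<noteq> 0 \<and> y \<noteq> 0 \<and> (\<exists>c d. c \<noteq> 0 \<and> d \<noteq> 0 \<and> scale c x = scale d y)}"

definition ray :: "('r :: zero \<Rightarrow> 'v :: zero \<Rightarrow> 'v) \<Rightarrow> 'v \<Rightarrow> 'v set" where
  "ray scale x = ray_rel scale `` {x}"

definition Rays :: "('r :: zero \<Rightarrow> 'v :: zero \<Rightarrow> 'v) \<Rightarrow> 'v set set" where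
  "Rays scale = (UNIV - {0}) // ray_rel scale"

text \<open>
  The set of all \<open>ray (c x + d y)\<close> does not depend on the representatives \<open>x \<in> X\<close>, \<open>y \<in> Y\<close>
  of the two rays, so collecting over all of them changes nothing (lemma \<open>ray_Icc_ray\<close> below).
\<close>
definition ray_Icc ::
  "('r :: zero \<Rightarrow> 'v :: comm_monoid_add \<Rightarrow> 'v) \<Rightarrow> 'v set \<Rightarrow> 'v set \<Rightarrow> 'v set set" where
  "ray_Icc scale X Y =
     {ray scale (scale c x + scale d y) | c d x y. x \<in> X \<and> y \<in> Y \<and> \<not> (c = 0 \<and> d = 0)}"

definition ray_Ico ::
  "('r :: zero \<Rightarrow> 'v :: comm_monoid_add \<Rightarrow> 'v) \<Rightarrow> 'v set \<Rightarrow> 'v set \<Rightarrow> 'v set set" where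
  "ray_Ico scale X Y = ray_Icc scale X Y - {Y}"

text \<open>The value is the same for all representatives of two rays (lemma \<open>CS_ray\<close> below).\<close>
definition CS ::
  "('v \<Rightarrow> 'r :: bipotent_semifield) \<Rightarrow> ('v \<Rightarrow> 'v \<Rightarrow> 'r) \<Rightarrow> 'v set \<Rightarrow> 'v set \<Rightarrow> 'r" where
  "CS q b X Y = (THE c. \<forall>x\<in>X. \<forall>y\<in>Y. c = b x y ^ 2 / (q x * q y))"

definition basic_function ::
  "('r :: bipotent_semifield \<Rightarrow> 'v :: comm_monoid_add \<Rightarrow> 'v) \<Rightarrow> ('v \<Rightarrow> 'r) \<Rightarrow> ('v \<Rightarrow> 'v \<Rightarrow> 'r) \<Rightarrow>
     'v set set \<Rightarrow> ('v set \<Rightarrow> 'r) \<Rightarrow> bool" where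
  "basic_function scale q b S f \<longleftrightarrow>
     (\<exists>\<gamma>. f = (\<lambda>X\<in>Rays scale. \<Sum>Y\<in>S. \<gamma> Y * CS q b Y X))"

datatype sign = Lt | Eq | Gt

fun sign_holds :: "sign \<Rightarrow> 'r :: linorder \<Rightarrow> 'r \<Rightarrow> bool" where
  "sign_holds Lt x y \<longleftrightarrow> x < y"
| "sign_holds Eq x y \<longleftrightarrow> x = y"
| "sign_holds Gt x y \<longleftrightarrow> x > y"

text \<open>
  Here \<open>f 1, \<dots>, f m\<close> enumerate the finite set of functions and \<open>\<sigma> k l\<close> is the sign imposed on
  \<open>f k\<close> and \<open>f l\<close>.
\<close>
definition satisfying_rays ::
  "('r :: {zero, linorder} \<Rightarrow> 'v :: zero \<Rightarrow> 'v) \<Rightarrow> nat \<Rightarrow> (nat \<Rightarrow> 'v set \<Rightarrow> 'r) \<Rightarrow> (nat \<Rightarrow> nat \<Rightarrow> sign) \<Rightarrow>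
     'v set set" where
  "satisfying_rays scale m f \<sigma> =
     {X \<in> Rays scale. \<forall>k l. 1 \<le> k \<and> k < l \<and> l \<le> m \<longrightarrow> sign_holds (\<sigma> k l) (f k X) (f l X)}"

definition stratum ::
  "('r :: {zero, linorder} \<Rightarrow> 'v :: zero \<Rightarrow> 'v) \<Rightarrow> nat \<Rightarrow> (nat \<Rightarrow> 'v set \<Rightarrow> 'r) \<Rightarrow> 'v set set \<Rightarrow> bool" where
  "stratum scale m f T \<longleftrightarrow> T \<noteq> {} \<and> (\<exists>\<sigma>. T = satisfying_rays scale m f \<sigma>)"

definition direct_derivate ::
  "('r :: zero \<Rightarrow> 'v :: comm_monoid_add \<Rightarrow> 'v) \<Rightarrow> 'v set set \<Rightarrow> 'v set set \<Rightarrow> bool" where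
  "direct_derivate scale T T' \<longleftrightarrow> T \<noteq> T' \<and>
     (\<exists>W\<in>T. \<exists>W'\<in>T'. \<exists>Z\<in>ray_Icc scale W W'.
        ray_Icc scale W W' \<inter> T = ray_Ico scale W Z \<and>
        ray_Icc scale W W' \<inter> T' = ray_Icc scale Z W' \<and>
        ray_Icc scale W W' \<subseteq> T \<union> T')"

definition L_set ::
  "('r :: zero \<Rightarrow> 'v :: comm_monoid_add \<Rightarrow> 'v) \<Rightarrow> 'v set set \<Rightarrow> 'v set set \<Rightarrow> 'v set set \<Rightarrow> 'v set set"
  where
  "L_set scale T T' U = {Z \<in> T'. \<forall>W\<in>U. ray_Ico scale W Z \<subseteq> T}"

definition S_set ::
  "('r :: zero \<Rightarrow> 'v :: comm_monoid_add \<Rightarrow> 'v) \<Rightarrow> 'v set set \<Rightarrow> 'v set set \<Rightarrow> 'v set set \<Rightarrow> 'v set set"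
  where
  "S_set scale T T' P = {W \<in> T. \<forall>Z\<in>P. ray_Ico scale W Z \<subseteq> T}"

lemma scale_nonzero:
  fixes scale :: "'r :: bipotent_semifield \<Rightarrow> 'v :: comm_monoid_add \<Rightarrow> 'v"
  assumes "semimodule scale" "c \<noteq> 0" "x \<noteq> 0"
  shows "scale c x \<noteq> 0"
proof
  assume "scale c x = 0"
  then have "scale (inverse c * c) x = 0"
    by (metis assms(1) semimodule.scale_scale semimodule.scale_zero_right)
  with assms show False by (simp add: left_inverse_nonzero semimodule.scale_one)
qed

lemma semimodule_add_nonzero:
  fixes scale :: "'r :: bipotent_semifield \<Rightarrow> 'v :: comm_monoid_add \<Rightarrow> 'v"
    and x y :: 'v
  assumes "semimodule scale" "x \<noteq> 0"
  shows "x + y \<noteq> 0"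
proof
  assume xy: "x + y = 0"
  have "(1 :: 'r) + 1 = 1" by (simp only: add_eq_max max.idem)
  then have "x + x = x"
    using semimodule.scale_add_left [OF assms(1), of 1 1 x] semimodule.scale_one [OF assms(1), of x]
    by simp
  then have "x + (x + y) = x + y" by (simp add: add.assoc [symmetric])
  with xy assms(2) show False by simp
qed

lemma equiv_ray_rel:
  fixes scale :: "'r :: bipotent_semifield \<Rightarrow> 'v :: comm_monoid_add \<Rightarrow> 'v"
  assumes "semimodule scale"
  shows "equiv (UNIV - {0}) (ray_rel scale)"
proof (rule equivI)
  show "ray_rel scale \<subseteq> (UNIV - {0}) \<times> (UNIV - {0})"
    unfolding ray_rel_def by blast
  show "refl_on (UNIV - {0}) (ray_rel scale)"
    unfolding refl_on_def ray_rel_def by (auto intro!: exI [of _ "1 :: 'r"])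
  show "sym (ray_rel scale)"
  proof (rule symI)
    fix x y assume "(x, y) \<in> ray_rel scale"
    then obtain c d where "x \<noteq> 0" "y \<noteq> 0" "c \<noteq> 0" "d \<noteq> 0" "scale d y = scale c x"
      unfolding ray_rel_def by auto
    then show "(y, x) \<in> ray_rel scale" unfolding ray_rel_def by blast
  qed
  show "trans (ray_rel scale)"
  proof (rule transI)
    fix x y z assume "(x, y) \<in> ray_rel scale" "(y, z) \<in> ray_rel scale"
    then obtain c d c' d' where nz: "x \<noteq> 0" "z \<noteq> 0" "c \<noteq> 0" "d \<noteq> 0" "c' \<noteq> 0" "d' \<noteq> 0"
      and e: "scale c x = scale d y" "scale c' y = scale d' z"
      unfolding ray_rel_def by blast
    have "scale (c' * c) x = scale (d * d') z"
      using e assms by (metis mult.commute semimodule.scale_scale)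
    then show "(x, z) \<in> ray_rel scale"
      unfolding ray_rel_def using nz bipotent_mult_nonzero by blast
  qed
qed

lemma ray_memD:
  fixes scale :: "'r :: bipotent_semifield \<Rightarrow> 'v :: comm_monoid_add \<Rightarrow> 'v"
  assumes "semimodule scale" "x' \<in> ray scale x"
  obtains c where "c \<noteq> 0" "x' = scale c x"
proof -
  from assms(2) obtain c d where cd: "c \<noteq> 0" "d \<noteq> 0" "scale c x = scale d x'"
    unfolding ray_def ray_rel_def by blast
  have "scale (inverse d * c) x = scale (inverse d * d) x'"
    by (metis cd(3) assms(1) semimodule.scale_scale)
  then have "x' = scale (inverse d * c) x"
    using cd(2) assms(1) by (simp add: left_inverse_nonzero semimodule.scale_one)
  moreover have "inverse d \<noteq> 0"
    using left_inverse_nonzero [OF cd(2)] by (metis mult_zero_left zero_neq_one)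
  then have "inverse d * c \<noteq> 0"
    using cd(1) by (rule bipotent_mult_nonzero)
  ultimately show thesis using that by blast
qed

lemma ray_self:
  fixes scale :: "'r :: bipotent_semifield \<Rightarrow> 'v :: comm_monoid_add \<Rightarrow> 'v"
  assumes "x \<noteq> 0"
  shows "x \<in> ray scale x"
  using assms unfolding ray_def ray_rel_def by (auto intro!: exI [of _ "1 :: 'r"])

lemma ray_Icc_ray:
  fixes scale :: "'r :: bipotent_semifield \<Rightarrow> 'v :: comm_monoid_add \<Rightarrow> 'v"
  assumes "semimodule scale" "x \<noteq> 0" "y \<noteq> 0"
  shows "ray_Icc scale (ray scale x) (ray scale y) =
    {ray scale (scale c x + scale d y) | c d. \<not> (c = 0 \<and> d = 0)}" (is "?A = ?B")
proof
  show "?B \<subseteq> ?A"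
    unfolding ray_Icc_def using ray_self assms by blast
  show "?A \<subseteq> ?B"
  proof
    fix Z assume "Z \<in> ?A"
    then obtain c d x' y' where h: "Z = ray scale (scale c x' + scale d y')"
      "x' \<in> ray scale x" "y' \<in> ray scale y" "\<not> (c = 0 \<and> d = 0)"
      unfolding ray_Icc_def by blast
    obtain u where u: "u \<noteq> 0" "x' = scale u x" by (rule ray_memD [OF assms(1) h(2)])
    obtain v where v: "v \<noteq> 0" "y' = scale v y" by (rule ray_memD [OF assms(1) h(3)])
    have "Z = ray scale (scale (c * u) x + scale (d * v) y)"
      using h(1) u(2) v(2) assms(1) by (simp add: semimodule.scale_scale)
    moreover have "\<not> (c * u = 0 \<and> d * v = 0)"
      using h(4) u(1) v(1) bipotent_mult_nonzero by blast
    ultimately show "Z \<in> ?B" by blast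
  qed
qed

lemma CS_ray:
  fixes scale :: "'r :: bipotent_semifield \<Rightarrow> 'v :: comm_monoid_add \<Rightarrow> 'v"
  assumes "semimodule scale" "quadratic_form_with_companion scale q b" "anisotropic q"
    and "x \<noteq> 0" "y \<noteq> 0"
  shows "CS q b (ray scale x) (ray scale y) = b x y ^ 2 / (q x * q y)"
proof -
  let ?c = "b x y ^ 2 / (q x * q y)"
  have eq: "?c = b x' y' ^ 2 / (q x' * q y')" if h: "x' \<in> ray scale x" "y' \<in> ray scale y" for x' y'
  proof -
    obtain u where u: "u \<noteq> 0" "x' = scale u x" by (rule ray_memD [OF assms(1) h(1)])
    obtain v where v: "v \<noteq> 0" "y' = scale v y" by (rule ray_memD [OF assms(1) h(2)])
    define w n where "w = (u * v) ^ 2" and "n = q x * q y"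
    have q: "q (scale c z) = c ^ 2 * q z" and b: "b (scale c z) z' = c * b z z'"
      "b z (scale c z') = c * b z z'" for c z z'
      using assms(2) unfolding quadratic_form_with_companion_def symmetric_bilinear_def by auto
    have 1: "b x' y' ^ 2 = w * b x y ^ 2"
      by (simp add: u v b w_def power_mult_distrib ac_simps)
    have 2: "q x' * q y' = w * n"
      by (simp add: u v q w_def n_def power_mult_distrib ac_simps)
    have w0: "w \<noteq> 0"
      unfolding w_def power2_eq_square using u v by (simp add: bipotent_mult_nonzero)
    have n0: "n \<noteq> 0"
      unfolding n_def using assms by (simp add: anisotropic_def bipotent_mult_nonzero)
    have inv: "inverse (w * n) * w = inverse n"
    proof -
      have "inverse (w * n) * (w * n) = 1"
        using w0 n0 bipotent_mult_nonzero left_inverse_nonzero by blast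
      then have "inverse (w * n) * w * (n * inverse n) = inverse n"
        by (metis mult.assoc mult_1_left)
      then show ?thesis
        using left_inverse_nonzero [OF n0] by (simp add: mult.commute [of n])
    qed
    show ?thesis
      unfolding 1 2 divide_eq_mult_inverse n_def [symmetric] inv [symmetric]
      by (simp add: ac_simps)
  qed
  show ?thesis
    unfolding CS_def
  proof (rule the_equality)
    show "\<forall>x'\<in>ray scale x. \<forall>y'\<in>ray scale y. ?c = b x' y' ^ 2 / (q x' * q y')"
      using eq by blast
  next
    fix c assume "\<forall>x'\<in>ray scale x. \<forall>y'\<in>ray scale y. c = b x' y' ^ 2 / (q x' * q y')"
    then show "c = ?c" using ray_self assms(4,5) by blast
  qed
qed

end

theory Submission imports Defs begin

text \<open>
  Write \<open>R W Z\<close> for \<open>[W, Z[ \<subseteq> T\<close>. Then \<open>L\<close> and \<open>S\<close> are the two polarity maps of the relation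
  \<open>R\<close> between \<open>T\<close> and \<open>T'\<close>: \<open>L U\<close> consists of the \<open>Z \<in> T'\<close> related to every \<open>W \<in> U\<close>, and \<open>S P\<close>
  of the \<open>W \<in> T\<close> related to every \<open>Z \<in> P\<close>. For \<open>U \<subseteq> T\<close> and \<open>P \<subseteq> T'\<close> both \<open>P \<subseteq> L U\<close> and
  \<open>U \<subseteq> S P\<close> say that \<open>R\<close> holds on all of \<open>U \<times> P\<close>, so \<open>L\<close> and \<open>S\<close> form an antitone Galois
  connection between the subsets of \<open>T\<close> and those of \<open>T'\<close>.

  The claim is then the standard behaviour of such a connection: the composites \<open>S \<circ> L\<close> and
  \<open>L \<circ> S\<close> are closure operators, a set of the form \<open>L U\<close> or \<open>S P\<close> is closed, and the closure of
  \<open>U\<close> is the largest subset of \<open>T\<close> with the same image as \<open>U\<close> under \<open>L\<close> (and dually for \<open>P\<close>).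
\<close>

lemma subset_L_set_iff_subset_S_set:
  assumes "U \<subseteq> T" "P \<subseteq> T'"
  shows "P \<subseteq> L_set scale T T' U \<longleftrightarrow> U \<subseteq> S_set scale T T' P"
  using assms unfolding L_set_def S_set_def by blast

text \<open>
  One half of the claim for any antitone Galois connection between the subsets of \<open>A\<close> and those
  of \<open>B\<close>. The hypotheses are symmetric in the two maps, so exchanging them gives the other half.
\<close>
lemma antitone_galois_closure:
  fixes F :: "'a set \<Rightarrow> 'b set" and G :: "'b set \<Rightarrow> 'a set"
  assumes galois: "\<And>U P. U \<subseteq> A \<Longrightarrow> P \<subseteq> B \<Longrightarrow> P \<subseteq> F U \<longleftrightarrow> U \<subseteq> G P"
    and F: "\<And>U. F U \<subseteq> B" and G: "\<And>P. G P \<subseteq> A"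
    and U: "U \<subseteq> A"
  shows "F (G (F U)) = F U"
    and "\<And>U1. U1 \<subseteq> A \<Longrightarrow> F U1 = F U \<Longrightarrow> U1 \<subseteq> G (F U)"
proof -
  have extensive: "U1 \<subseteq> G (F U1)" if "U1 \<subseteq> A" for U1
    using galois [OF that F] by blast
  show "F (G (F U)) = F U"
  proof
    \<comment> \<open>\<open>F\<close> reverses the inclusion \<open>U \<subseteq> G (F U)\<close>.\<close>
    have "U \<subseteq> G (F (G (F U)))"
      using extensive [OF U] extensive [OF G] by blast
    then show "F (G (F U)) \<subseteq> F U"
      using galois [OF U F] by blast
    show "F U \<subseteq> F (G (F U))"
      using galois [OF G F] by blast
  qed
  show "U1 \<subseteq> G (F U)" if "U1 \<subseteq> A" "F U1 = F U" for U1
    using extensive [OF that(1)] that(2) by simp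
qed

theorem theorem4p19:
  fixes scale :: "'r :: bipotent_semifield \<Rightarrow> 'v :: comm_monoid_add \<Rightarrow> 'v"
    and q :: "'v \<Rightarrow> 'r" and b :: "'v \<Rightarrow> 'v \<Rightarrow> 'r"
    and Ys :: "'v set set"
    and m :: nat and f :: "nat \<Rightarrow> 'v set \<Rightarrow> 'r"
    and T T' :: "'v set set"
  assumes "root_closed TYPE('r)"
    and "semimodule scale"
    and "quadratic_form_with_companion scale q b"
    and "anisotropic q"
    and "finite Ys" and "Ys \<subseteq> Rays scale"
    and "\<forall>k\<in>{1..m}. basic_function scale q b Ys (f k)"
    and "stratum scale m f T" and "stratum scale m f T'"
    and "direct_derivate scale T T'"
  defines "L \<equiv> L_set scale T T'" and "S \<equiv> S_set scale T T'"
  shows "(\<forall>U. U \<noteq> {} \<and> U \<subseteq> T \<and> L U \<noteq> {} \<longrightarrow>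
            L (S (L U)) = L U \<and>
            (\<forall>U1. U1 \<subseteq> T \<and> U \<subseteq> U1 \<and> L U1 = L U \<longrightarrow> U1 \<subseteq> S (L U)))
       \<and> (\<forall>P. P \<noteq> {} \<and> P \<subseteq> T' \<and> S P \<noteq> {} \<longrightarrow>
            S (L (S P)) = S P \<and>
            (\<forall>P1. P1 \<subseteq> T' \<and> P \<subseteq> P1 \<and> S P1 = S P \<longrightarrow> P1 \<subseteq> L (S P)))"
proof -
  have galois: "P \<subseteq> L U \<longleftrightarrow> U \<subseteq> S P" if "U \<subseteq> T" "P \<subseteq> T'" for U P
    unfolding L_def S_def using that by (rule subset_L_set_iff_subset_S_set)
  have L: "L U \<subseteq> T'" for U
    unfolding L_def L_set_def by blast
  have S: "S P \<subseteq> T" for P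
    unfolding S_def S_set_def by blast
  note LS = antitone_galois_closure [of T T' L S, OF galois L S]
  note SL = antitone_galois_closure [of T' T S L, OF galois [symmetric] S L]
  show ?thesis
    using LS SL by simp
qed

end
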